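(* $$4\sum_{\substack{a,b,c,d\in\mathbb{Z}_{\ge 0}\\ ad-bc=1}} \left(a\arctan\left(\frac{a}{b}\right)+c\arctan\left(\frac{c}{d}\right)-(a+c)\arctan\left(\frac{a+c}{b+d}\right)\right)^2=\pi ,$$ where the sum runs over all quadruples $(a,b,c,d)$ of non-negative integers with $ad-bc=1$.
   Context: When $b=0$ (which forces $a=d=1$), $\arctan(a/b)$ is understood as $\pi/2$; that is, $\arctan(a/b)\in[0,\pi/2]$ is the angle between the vector $(a,b)$ and the positive $y$-axis. *)

theory Defs
  imports "HOL-Analysis.Analysis"
begin

text \<open>
  The angle in \<open>[0, \<pi>/2]\<close> between the vector \<open>(a, b)\<close> and the positive \<open>y\<close>-axis. The case
  \<open>b = 0\<close> must be separated, since \<open>arctan (a / 0) = arctan 0 = 0\<close> in HOL; the value at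
  \<open>a = b = 0\<close> is irrelevant.
\<close>

definition arctan_ratio :: "nat \<Rightarrow> nat \<Rightarrow> real" where
  "arctan_ratio a b = (if b = 0 then pi / 2 else arctan (real a / real b))"

end

theory Submission
  imports Defs
begin

text \<open>
  Let \<open>\<theta>(a,b)\<close> be the angle between \<open>(a,b)\<close> and the \<open>y\<close>-axis and put \<open>F(a,b) = a \<theta>(a,b)\<close>. This is
  the support function of a cycloid arc. For \<open>u = (a,b)\<close>, \<open>v = (c,d)\<close> of determinant \<open>1\<close>,
  \<open>(F(u) + F(v) - F(u + v))\<^sup>2\<close> is twice the area of the triangle which the tangent line with normal
  \<open>u + v\<close> cuts off from the corner formed by the tangent lines with normals \<open>u\<close> and \<open>v\<close>. Descending
  the Stern--Brocot tree of pairs \<open>(u,v)\<close>, the triangles exhaust the region between the corner at the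
  root and the arc, whose doubled area is \<open>\<pi>/4\<close>. What remains to be cut off at \<open>(u,v)\<close> is at most
  \<open>\<epsilon> sin\<^sup>2 \<epsilon> = \<epsilon> / (1 + (u \<bullet> v)\<^sup>2)\<close>, where \<open>\<epsilon> = \<theta>(u) - \<theta>(v)\<close>. The angles \<open>\<epsilon>\<close> on each level of the
  tree add up to \<open>\<pi>/2\<close>, and \<open>u \<bullet> v\<close> is at least the depth, so the remainder tends to \<open>0\<close>.
\<close>

section \<open>Telescoping sums over trees\<close>

lemma has_sum_levels_nonneg:
  fixes f :: "'a \<Rightarrow> real" and rank :: "'a \<Rightarrow> nat"
  assumes nonneg: "\<And>x. x \<in> A \<Longrightarrow> f x \<ge> 0"
    and level: "\<And>n. (f has_sum g n) {x \<in> A. rank x = n}"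
    and sums: "g sums s"
  shows "(f has_sum s) A"
proof -
  let ?L = "\<lambda>n. {x \<in> A. rank x = n}"
  have "g n \<ge> 0" for n
    using level by (rule has_sum_nonneg) (simp add: nonneg)
  with sums have g_has_sum: "(g has_sum s) UNIV"
    by (rule sums_nonneg_imp_has_sum)
  have "(\<lambda>(n, x). f x) summable_on Sigma UNIV ?L"
    using level nonneg by (intro summable_on_SigmaI[OF _ has_sum_imp_summable[OF g_has_sum]]) auto
  then have "((\<lambda>(n, x). f x) has_sum s) (Sigma UNIV ?L)"
    using level by (intro has_sum_SigmaI[OF _ g_has_sum]) auto
  then show ?thesis
    by (subst has_sum_reindex_bij_witness[where S = A and T = "Sigma UNIV ?L" and
          i = snd and j = "\<lambda>x. (rank x, x)"]) auto
qed

lemma sum_lists_length_Suc: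
  fixes f :: "'a :: finite list \<Rightarrow> 'b :: comm_monoid_add"
  shows "(\<Sum>xs | length xs = Suc n. f xs) = (\<Sum>xs | length xs = n. \<Sum>x\<in>UNIV. f (x # xs))"
proof -
  have lists: "{xs :: 'a list. length xs = Suc n} = (\<lambda>(xs, x). x # xs) ` ({xs. length xs = n} \<times> UNIV)"
    using lists_length_Suc_eq[of UNIV n] by simp
  show ?thesis
    unfolding lists sum.cartesian_product
    by (subst sum.reindex) (auto simp: inj_on_def case_prod_unfold)
qed

lemma sum_lists_telescope:
  fixes f V :: "'a :: finite list \<Rightarrow> 'b :: ab_group_add"
  assumes "\<And>xs. (\<Sum>x\<in>UNIV. V (x # xs)) = V xs - f xs"
  shows "(\<Sum>xs | length xs = n. V xs) = V [] - (\<Sum>k<n. \<Sum>xs | length xs = k. f xs)"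
  by (induction n) (simp_all add: sum_lists_length_Suc assms sum_subtractf algebra_simps)

lemma has_sum_lists_telescope:
  fixes f V W :: "'a :: finite list \<Rightarrow> real"
  assumes nonneg: "\<And>xs. f xs \<ge> 0"
    and V_split: "\<And>xs. (\<Sum>x\<in>UNIV. V (x # xs)) = V xs - f xs"
    and W_split: "\<And>xs. (\<Sum>x\<in>UNIV. W (x # xs)) = W xs"
    and V_le: "\<And>xs. \<bar>V xs\<bar> \<le> c (length xs) * W xs"
    and c_tendsto_0: "c \<longlonglongrightarrow> 0"
  shows "(f has_sum V []) UNIV"
proof (rule has_sum_levels_nonneg)
  show "(f has_sum (\<Sum>xs | length xs = n. f xs)) {xs \<in> UNIV. length xs = n}" for n
    using finite_lists_length_eq[of "UNIV :: 'a set" n] by (simp add: has_sum_finite)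
  have W_level: "(\<Sum>xs | length xs = n. W xs) = W []" for n
    using sum_lists_telescope[of W "\<lambda>_. 0"] W_split by simp
  have "norm (\<Sum>xs | length xs = n. V xs) \<le> c n * W []" for n
  proof -
    have "norm (\<Sum>xs | length xs = n. V xs) \<le> (\<Sum>xs | length xs = n. c n * W xs)"
      using V_le by (intro sum_norm_le) auto
    then show ?thesis
      by (simp add: W_level flip: sum_distrib_left)
  qed
  moreover have "(\<lambda>n. c n * W []) \<longlonglongrightarrow> 0"
    using c_tendsto_0 by (rule tendsto_mult_left_zero)
  ultimately have "(\<lambda>n. \<Sum>xs | length xs = n. V xs) \<longlonglongrightarrow> 0"
    by (rule Lim_null_comparison[OF always_eventually[OF allI]])
  then have "(\<lambda>n. V [] - (\<Sum>xs | length xs = n. V xs)) \<longlonglongrightarrow> V [] - 0"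
    by (intro tendsto_intros)
  then show "(\<lambda>n. \<Sum>xs | length xs = n. f xs) sums V []"
    by (simp add: sums_def sum_lists_telescope[OF V_split])
qed (rule nonneg)

section \<open>The Stern--Brocot tree\<close>

type_synonym quad = "nat \<times> nat \<times> nat \<times> nat"

definition unimodular :: "quad set" where
  "unimodular = {(a, b, c, d). int a * int d - int b * int c = 1}"

definition root :: quad where
  "root = (1, 0, 0, 1)"

fun child :: "bool \<Rightarrow> quad \<Rightarrow> quad" where
  "child True (a, b, c, d) = (a, b, a + c, b + d)"
| "child False (a, b, c, d) = (a + c, b + d, c, d)"

definition node :: "bool list \<Rightarrow> quad" where
  "node xs = foldr child xs root"

lemma node_Nil [simp]: "node [] = root"
  and node_Cons [simp]: "node (x # xs) = child x (node xs)"
  by (simp_all add: node_def)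

lemma unimodular_iff: "(a, b, c, d) \<in> unimodular \<longleftrightarrow> a * d = b * c + 1"
proof -
  have "(a, b, c, d) \<in> unimodular \<longleftrightarrow> int (a * d) = int (b * c + 1)"
    by (auto simp: unimodular_def)
  then show ?thesis
    by (simp only: of_nat_eq_iff)
qed

lemma unimodular_imp_pos:
  assumes "(a, b, c, d) \<in> unimodular"
  shows "a > 0" "d > 0"
proof -
  have "a * d \<noteq> 0"
    using assms by (simp add: unimodular_iff)
  then show "a > 0" "d > 0"
    by simp_all
qed

lemma root_unimodular: "root \<in> unimodular"
  by (simp add: root_def unimodular_iff)

lemma child_unimodular_iff: "child x m \<in> unimodular \<longleftrightarrow> m \<in> unimodular"
  by (cases x; cases m) (simp_all add: unimodular_iff algebra_simps)

lemma node_unimodular: "node xs \<in> unimodular"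
  by (induction xs) (simp_all add: root_unimodular child_unimodular_iff)

lemma child_neq_root: "m \<in> unimodular \<Longrightarrow> child x m \<noteq> root"
  by (cases x; cases m) (auto simp: root_def dest: unimodular_imp_pos)

lemma child_eq_iff:
  assumes "m \<in> unimodular" "m' \<in> unimodular"
  shows "child x m = child y m' \<longleftrightarrow> x = y \<and> m = m'"
  using assms by (cases x; cases y; cases m; cases m') (auto dest: unimodular_imp_pos)

lemma unimodular_cases:
  assumes "m \<in> unimodular"
  obtains (root) "m = root" | (child) x m' where "m' \<in> unimodular" "m = child x m'"
proof -
  obtain a b c d where m_eq: "m = (a, b, c, d)"
    by (cases m)
  have det: "a * d = b * c + 1"
    using assms m_eq by (simp add: unimodular_iff)
  consider (first_le) "a \<le> c \<and> b \<le> d" | (second_le) "c \<le> a \<and> d \<le> b"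
    | (antidiagonal_greater) "a < c \<and> d < b" | (diagonal_greater) "c < a \<and> b < d"
    by linarith
  then show thesis
  proof cases
    case first_le
    then have "m = child True (a, b, c - a, d - b)"
      by (simp add: m_eq)
    with assms child show thesis
      by (metis child_unimodular_iff)
  next
    case second_le
    then have "m = child False (a - c, b - d, c, d)"
      by (simp add: m_eq)
    with assms child show thesis
      by (metis child_unimodular_iff)
  next
    case antidiagonal_greater
    then have "a * d \<le> c * b"
      by (intro mult_le_mono) auto
    with det show thesis
      by (simp add: mult.commute)
  next
    case diagonal_greater
    then have "(c + 1) * (b + 1) \<le> a * d"
      by (intro mult_le_mono) auto
    with det have "b = 0" "c = 0"
      by (auto simp: algebra_simps)
    with det have "m = root"
      by (simp add: m_eq root_def)
    then show thesis
      by (rule root)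
  qed
qed

lemma inj_node: "inj node"
proof (rule injI)
  show "node xs = node ys \<Longrightarrow> xs = ys" for xs ys
  proof (induction xs arbitrary: ys)
    case Nil
    then show ?case
      using child_neq_root[OF node_unimodular] by (cases ys) (auto dest: sym)
  next
    case (Cons x xs)
    then show ?case
      using child_neq_root[OF node_unimodular] by (cases ys) (auto simp: child_eq_iff node_unimodular)
  qed
qed

lemma unimodular_imp_node: "m \<in> unimodular \<Longrightarrow> m \<in> range node"
proof (induction "case m of (a, b, c, d) \<Rightarrow> a + b + c + d" arbitrary: m rule: less_induct)
  case less
  from less.prems show ?case
  proof (cases rule: unimodular_cases)
    case root
    then show ?thesis
      using node_Nil by (metis rangeI)
  next
    case (child x m')
    then have "m' \<in> range node"
      by (intro less.hyps; cases x; cases m') (auto dest: unimodular_imp_pos)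
    then show ?thesis
      using child(2) node_Cons by (metis imageE rangeI)
  qed
qed

lemma bij_betw_node: "bij_betw node UNIV unimodular"
  using inj_node node_unimodular unimodular_imp_node by (auto simp: bij_betw_def)

fun dot :: "quad \<Rightarrow> nat" where
  "dot (a, b, c, d) = a * c + b * d"

lemma dot_less_dot_child:
  assumes "m \<in> unimodular"
  shows "dot m < dot (child x m)"
proof (cases m)
  case (fields a b c d)
  then have "0 < a * a + b * b" "0 < c * c + d * d"
    using assms unimodular_imp_pos[of a b c d] by simp_all
  then show ?thesis
    by (cases x) (simp_all add: fields algebra_simps)
qed

lemma length_le_dot_node: "length xs \<le> dot (node xs)"
proof (induction xs)
  case (Cons x xs)
  then show ?case
    using dot_less_dot_child[OF node_unimodular, of xs x] by simp
qed simp

section \<open>The area of a corner\<close>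

lemma mult_cos_le_sin:
  assumes "0 \<le> x" "x \<le> pi / 2"
  shows "x * cos x \<le> sin x"
proof (cases "x = pi / 2")
  case True
  show ?thesis
    unfolding True by simp
next
  case False
  with assms have x_bounds: "0 \<le> x" "x < pi / 2"
    by auto
  then have "x \<le> tan x"
    using arctan_le_self[of "tan x"] by (simp add: tan_pos_pi2_le arctan_tan)
  moreover have "cos x > 0"
    using x_bounds by (intro cos_gt_zero_pi) auto
  ultimately show ?thesis
    by (simp add: tan_def field_simps)
qed

lemma diff_sin_mult_cos_le:
  fixes x :: real
  assumes "0 \<le> x" "x \<le> pi / 2"
  shows "x - sin x * cos x \<le> x * (sin x)\<^sup>2"
proof -
  have "x * cos x * cos x \<le> sin x * cos x"
    using assms by (intro mult_right_mono mult_cos_le_sin cos_ge_zero) auto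
  then show ?thesis
    unfolding sin_squared_eq by (simp add: power2_eq_square algebra_simps)
qed

lemma sin_squared_le_square: "(sin x)\<^sup>2 \<le> x\<^sup>2" for x :: real
  using abs_sin_x_le_abs_x by (simp add: abs_le_square_iff)

lemma mult_diff_sin_squared_le:
  fixes x p :: real
  assumes x_bounds: "0 < x" "x \<le> pi / 2" and p_le: "p * sin x \<le> cos x"
  shows "p * (x\<^sup>2 - (sin x)\<^sup>2) \<le> x - sin x * cos x"
proof -
  have sin_pos: "0 < sin x"
    using x_bounds by (intro sin_gt_zero) auto
  have "sin x * (p * (x\<^sup>2 - (sin x)\<^sup>2)) = (p * sin x) * (x\<^sup>2 - (sin x)\<^sup>2)"
    by simp
  also have "\<dots> \<le> cos x * (x\<^sup>2 - (sin x)\<^sup>2)"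
    using p_le sin_squared_le_square by (intro mult_right_mono) auto
  also have "\<dots> = x * (x * cos x) - sin x * (sin x * cos x)"
    by (simp add: power2_eq_square algebra_simps)
  also have "\<dots> \<le> sin x * (x - sin x * cos x)"
    using mult_left_mono[OF mult_cos_le_sin, of x x] x_bounds by (simp add: algebra_simps)
  finally show ?thesis
    using sin_pos by simp
qed

lemma arctan_ratio_polar:
  obtains r where "r \<ge> 0"
    "real a = r * sin (arctan_ratio a b)" "real b = r * cos (arctan_ratio a b)"
proof
  let ?r = "sqrt ((real a)\<^sup>2 + (real b)\<^sup>2)"
  have "?r = real b * sqrt (1 + (real a / real b)\<^sup>2)" if "b > 0"
  proof -
    have "(real a)\<^sup>2 + (real b)\<^sup>2 = (real b)\<^sup>2 * (1 + (real a / real b)\<^sup>2)"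
      using that by (simp add: field_simps)
    then show ?thesis
      by (simp add: real_sqrt_mult)
  qed
  moreover have "sqrt (1 + (real a / real b)\<^sup>2) > 0"
    by (simp add: add_pos_nonneg)
  ultimately show "real a = ?r * sin (arctan_ratio a b)" "real b = ?r * cos (arctan_ratio a b)"
    by (auto simp: arctan_ratio_def sin_arctan cos_arctan)
qed simp

lemma arctan_ratio_nonneg: "0 \<le> arctan_ratio a b"
  by (simp add: arctan_ratio_def)

lemma arctan_ratio_le_pi_half: "arctan_ratio a b \<le> pi / 2"
  using less_imp_le[OF arctan_ubound] by (simp add: arctan_ratio_def)

fun angle :: "quad \<Rightarrow> real" where
  "angle (a, b, c, d) = arctan_ratio a b - arctan_ratio c d"

fun defect :: "quad \<Rightarrow> real" where
  "defect (a, b, c, d) = real a * arctan_ratio a b + real c * arctan_ratio c d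
     - real (a + c) * arctan_ratio (a + c) (b + d)"

text \<open>
  Twice the area enclosed by the arc and its tangent lines with normals \<open>(a,b)\<close> and \<open>(c,d)\<close>,
  provided that these vectors have determinant \<open>1\<close>.
\<close>

fun corner_area :: "quad \<Rightarrow> real" where
  "corner_area (a, b, c, d) = (let x = arctan_ratio a b; y = arctan_ratio c d in
     (x - y) / 2 - (sin (2 * x) - sin (2 * y)) / 4 - real a * real c * (x - y)\<^sup>2)"

lemma angle_split: "angle (child True m) + angle (child False m) = angle m"
  by (cases m) simp

lemma corner_area_split:
  "corner_area (child True m) + corner_area (child False m) = corner_area m - (defect m)\<^sup>2"
  by (cases m) (simp add: Let_def power2_eq_square diff_divide_distrib add_divide_distrib algebra_simps)

lemma unimodular_polar:
  assumes "(a, b, c, d) \<in> unimodular"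
  obtains k where "k \<ge> 0" "k * sin (arctan_ratio a b - arctan_ratio c d) = 1"
    "real a * real c = k * (sin (arctan_ratio a b) * sin (arctan_ratio c d))"
    "real b * real d = k * (cos (arctan_ratio a b) * cos (arctan_ratio c d))"
proof -
  obtain r where r_nonneg: "r \<ge> 0"
    and first_polar: "real a = r * sin (arctan_ratio a b)" "real b = r * cos (arctan_ratio a b)"
    by (rule arctan_ratio_polar)
  obtain s where s_nonneg: "s \<ge> 0"
    and second_polar: "real c = s * sin (arctan_ratio c d)" "real d = s * cos (arctan_ratio c d)"
    by (rule arctan_ratio_polar)
  have "real a * real d - real b * real c = 1"
    using assms by (simp add: unimodular_iff flip: of_nat_mult)
  then have "r * s * sin (arctan_ratio a b - arctan_ratio c d) = 1"
    by (simp add: first_polar second_polar sin_diff algebra_simps)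
  with r_nonneg s_nonneg first_polar second_polar show thesis
    by (intro that[of "r * s"]) (simp_all add: mult_ac)
qed

lemma angle_le_pi_half: "angle m \<le> pi / 2"
proof (cases m)
  case (fields a b c d)
  then show ?thesis
    using arctan_ratio_nonneg[of c d] arctan_ratio_le_pi_half[of a b] by simp
qed

lemma angle_pos:
  assumes "m \<in> unimodular"
  shows "0 < angle m"
proof (cases m)
  case (fields a b c d)
  obtain k where k_nonneg: "k \<ge> 0" and k_mult_sin: "k * sin (angle m) = 1"
    using assms unimodular_polar[of a b c d] by (auto simp: fields)
  show ?thesis
  proof (rule ccontr)
    assume "\<not> 0 < angle m"
    moreover have "- angle m \<le> pi"
      using arctan_ratio_nonneg[of a b] arctan_ratio_le_pi_half[of c d] pi_ge_zero
      unfolding fields angle.simps by linarith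
    ultimately have "sin (angle m) \<le> 0"
      using sin_ge_zero[of "- angle m"] by simp
    then have "k * sin (angle m) \<le> 0"
      using k_nonneg by (rule mult_nonneg_nonpos[rotated])
    with k_mult_sin show False
      by simp
  qed
qed

lemma dot_mult_sin_angle:
  assumes "m \<in> unimodular"
  shows "real (dot m) * sin (angle m) = cos (angle m)"
proof (cases m)
  case (fields a b c d)
  obtain k where k_mult_sin: "k * sin (arctan_ratio a b - arctan_ratio c d) = 1"
    and products: "real a * real c = k * (sin (arctan_ratio a b) * sin (arctan_ratio c d))"
      "real b * real d = k * (cos (arctan_ratio a b) * cos (arctan_ratio c d))"
    using assms[unfolded fields] by (rule unimodular_polar)
  have "real (dot m) = k * cos (angle m)"
    by (simp add: fields products cos_diff distrib_left)
  then have "real (dot m) * sin (angle m) = (k * sin (angle m)) * cos (angle m)"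
    by simp
  with k_mult_sin show ?thesis
    by (simp add: fields)
qed

lemma sin_angle_squared:
  assumes "m \<in> unimodular"
  shows "(sin (angle m))\<^sup>2 = 1 / (1 + (real (dot m))\<^sup>2)"
proof -
  have "(sin (angle m))\<^sup>2 * (1 + (real (dot m))\<^sup>2) = (sin (angle m))\<^sup>2 + (real (dot m) * sin (angle m))\<^sup>2"
    by (simp add: power_mult_distrib algebra_simps)
  also have "\<dots> = 1"
    by (simp add: dot_mult_sin_angle[OF assms])
  finally show ?thesis
    by (simp add: eq_divide_eq add_nonneg_eq_0_iff)
qed

lemma corner_area_eq:
  assumes "(a, b, c, d) \<in> unimodular"
  defines "e \<equiv> angle (a, b, c, d)"
  shows "corner_area (a, b, c, d) = (e - sin e * cos e) / 2 - real a * real c * (e\<^sup>2 - (sin e)\<^sup>2)"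
proof -
  define x y where "x = arctan_ratio a b" and "y = arctan_ratio c d"
  have e_eq: "e = x - y"
    by (simp add: e_def x_def y_def)
  obtain k where k_mult_sin: "k * sin e = 1" and ac_eq: "real a * real c = k * (sin x * sin y)"
    using unimodular_polar[OF assms(1)] by (auto simp: e_eq x_def y_def)
  have "(sin (2 * x) - sin (2 * y)) / 2 = sin e * cos (x + y)"
    using sin_diff_sin[of "2 * x" "2 * y"] by (simp add: e_eq diff_divide_distrib add_divide_distrib)
  also have "\<dots> = sin e * cos e - 2 * ((sin x * sin y) * sin e)"
    by (simp add: e_eq cos_add cos_diff algebra_simps)
  also have "(sin x * sin y) * sin e = real a * real c * (sin e)\<^sup>2"
    using k_mult_sin by (simp add: ac_eq power2_eq_square algebra_simps)
  finally show ?thesis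
    by (simp add: Let_def e_eq field_simps flip: x_def y_def)
qed

lemma abs_corner_area_le:
  assumes "m \<in> unimodular"
  shows "\<bar>corner_area m\<bar> \<le> angle m / (1 + (real (dot m))\<^sup>2)"
proof (cases m)
  case (fields a b c d)
  define e where "e = angle m"
  have e_bounds: "0 < e" "e \<le> pi / 2"
    using angle_pos[OF assms] angle_le_pi_half by (simp_all add: e_def)
  have "real a * real c * sin e \<le> real (dot m) * sin e"
    using e_bounds by (intro mult_right_mono sin_ge_zero) (auto simp: fields)
  then have "real a * real c * sin e \<le> cos e"
    by (simp add: dot_mult_sin_angle[OF assms] e_def)
  with e_bounds have excess_le: "real a * real c * (e\<^sup>2 - (sin e)\<^sup>2) \<le> e - sin e * cos e"
    by (rule mult_diff_sin_squared_le)
  have excess_nonneg: "0 \<le> real a * real c * (e\<^sup>2 - (sin e)\<^sup>2)"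
    using sin_squared_le_square by simp
  have "\<bar>s / 2 - t\<bar> \<le> s" if "t \<le> s" "0 \<le> t" for s t :: real
    using that by linarith
  from this[OF excess_le excess_nonneg] have "\<bar>corner_area m\<bar> \<le> e - sin e * cos e"
    using corner_area_eq[of a b c d] assms by (simp add: fields e_def)
  also have "\<dots> \<le> e * (sin e)\<^sup>2"
    using e_bounds by (intro diff_sin_mult_cos_le) auto
  also have "\<dots> = angle m / (1 + (real (dot m))\<^sup>2)"
    by (simp add: e_def sin_angle_squared[OF assms])
  finally show ?thesis .
qed

lemma abs_corner_area_node_le:
  "\<bar>corner_area (node xs)\<bar> \<le> inverse (real (Suc (length xs))) * angle (node xs)"
proof -
  have "length xs \<le> (dot (node xs))\<^sup>2"
    using length_le_dot_node le_square unfolding power2_eq_square by (rule order_trans)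
  then have Suc_length_le: "real (Suc (length xs)) \<le> 1 + (real (dot (node xs)))\<^sup>2"
    by (simp flip: of_nat_power)
  have "\<bar>corner_area (node xs)\<bar> \<le> angle (node xs) / (1 + (real (dot (node xs)))\<^sup>2)"
    by (rule abs_corner_area_le[OF node_unimodular])
  also have "\<dots> \<le> angle (node xs) / real (Suc (length xs))"
    using Suc_length_le angle_pos[OF node_unimodular, of xs]
    by (intro divide_left_mono mult_pos_pos add_pos_nonneg) auto
  finally show ?thesis
    by (simp add: divide_inverse mult.commute)
qed

lemma has_sum_defect_squared: "((\<lambda>m. (defect m)\<^sup>2) has_sum (pi / 4)) unimodular"
proof -
  have "((\<lambda>xs. (defect (node xs))\<^sup>2) has_sum corner_area (node [])) UNIV"
  proof (rule has_sum_lists_telescope)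
    show "(\<Sum>x\<in>UNIV. corner_area (node (x # xs))) = corner_area (node xs) - (defect (node xs))\<^sup>2" for xs
      using corner_area_split[of "node xs"] by (simp add: UNIV_bool add.commute)
    show "(\<Sum>x\<in>UNIV. angle (node (x # xs))) = angle (node xs)" for xs
      using angle_split[of "node xs"] by (simp add: UNIV_bool add.commute)
  qed (use abs_corner_area_node_le LIMSEQ_inverse_real_of_nat in simp_all)
  then have "((\<lambda>m. (defect m)\<^sup>2) has_sum corner_area root) unimodular"
    using has_sum_reindex_bij_betw[OF bij_betw_node, of "\<lambda>m. (defect m)\<^sup>2"] by simp
  then show ?thesis
    by (simp add: root_def arctan_ratio_def)
qed

theorem mainTheorem1:
  shows "4 * (\<Sum>\<^sub>\<infinity>(a, b, c, d) \<in> {(a :: nat, b :: nat, c :: nat, d :: nat).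
                 int a * int d - int b * int c = 1}.
              (real a * arctan_ratio a b + real c * arctan_ratio c d
                - real (a + c) * arctan_ratio (a + c) (b + d))\<^sup>2) = pi"
proof -
  have "(\<lambda>m. (defect m)\<^sup>2) = (\<lambda>(a, b, c, d). (real a * arctan_ratio a b + real c * arctan_ratio c d
      - real (a + c) * arctan_ratio (a + c) (b + d))\<^sup>2)"
    by auto
  then show ?thesis
    using infsumI[OF has_sum_defect_squared] by (simp only: unimodular_def)
qed

end
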